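(* For every integer $r\ge1$, $$p_r=r\sum_{\ell=0}^{\infty}\Biggl[\frac{1}{r(\ell+1)}+\sum_{m=1}^{\infty}(-1)^m\left(\frac{1}{r(\ell+1)+g_m^-}+\frac{1}{r(\ell+1)+g_m^+}\right)\Biggr],$$ where, for each fixed $\ell$, the inner series with respect to $m$ is evaluated first.
   Context: Let $(Y_r)_{r\ge1}$ be a sequence of independent random variables such that $Y_r$ has the exponential distribution with rate $r$ (density $r e^{-rt}$, $t>0$) for every $r\ge1$. For $r\ge 1$ define $p_r:=\mathbb P\left(Y_r=\max_{k\ge1}Y_k\right)$, the event being that $Y_k\le Y_r$ for all $k\ge1$. The generalized pentagonal numbers are $g_m^-=\frac{m(3m-1)}{2}$ and $g_m^+=\frac{m(3m+1)}{2}$ for integers $m\ge1$. *)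

theory Defs
  imports "HOL-Probability.Probability"
begin

definition pentagonal_minus :: "nat \<Rightarrow> real" where
  "pentagonal_minus m = real m * (3 * real m - 1) / 2"

definition pentagonal_plus :: "nat \<Rightarrow> real" where
  "pentagonal_plus m = real m * (3 * real m + 1) / 2"

(* The sequence is indexed by k >= 1; the value Y 0 plays no role. *)
definition max_prob :: "'a measure \<Rightarrow> (nat \<Rightarrow> 'a \<Rightarrow> real) \<Rightarrow> nat \<Rightarrow> real" where
  "max_prob M Y r = measure M {\<omega> \<in> space M. \<forall>k\<ge>1. Y k \<omega> \<le> Y r \<omega>}"

(* The terms of the inner series, which starts at m = 1; to be summed over m = Suc n. *)
definition inner_term :: "nat \<Rightarrow> nat \<Rightarrow> nat \<Rightarrow> real" where
  "inner_term r l m = (-1) ^ m *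
     (1 / (real r * (real l + 1) + pentagonal_minus m) +
      1 / (real r * (real l + 1) + pentagonal_plus m))"

definition outer_term :: "nat \<Rightarrow> nat \<Rightarrow> real" where
  "outer_term r l = 1 / (real r * (real l + 1)) + (\<Sum>n. inner_term r l (Suc n))"

end

(* Conditioning on Y_r = y and letting n tend to infinity in P(Y_k <= Y_r for all k <= n) gives
   p_r / r as the integral over y > 0 of e^(-ry) times the product of (1 - e^(-ky)) over k <> r.
   With phi(y) the product over all k, the integrand is e^(-ry) phi(y) / (1 - e^(-ry)), the sum of the
   nonnegative functions e^(-r(l+1)y) phi(y), so the integral can be taken termwise.
   Euler's pentagonal number theorem expands phi(y) as 1 + sum_m (-1)^m (e^(-g_m^- y) + e^(-g_m^+ y)),
   and integrating each of these summands termwise is legitimate because sum 1/g_m converges.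
   The pentagonal number theorem itself is the limit of Shanks' finite identity, in which all terms
   but the first tend to 0 with total at most n x^n. *)

theory Submission
  imports Defs
begin

section \<open>The pentagonal number theorem, from Shanks' finite identity\<close>

text \<open>The inductive step of Shanks' finite form of the pentagonal number theorem: splitting the
  factor \<open>1 - x ^ Suc n\<close>, the second part of the term \<open>s\<close> combines with the first part of the term
  \<open>s + 1\<close> to the corresponding term for \<open>n\<close>.  The exponents \<open>\<Sum>{..s}\<close> are triangular numbers.\<close>

lemma shanks_step:
  fixes x :: "'a::comm_ring_1"
  assumes "j \<le> n"
  shows "(\<Sum>s\<le>j. (- 1) ^ s * x ^ (s * Suc n + \<Sum>{..s}) * (\<Prod>k=Suc s..n. 1 - x ^ k)) * (1 - x ^ Suc n) =
         (\<Sum>s\<le>j. (- 1) ^ s * x ^ (s * n + \<Sum>{..s}) * (\<Prod>k=Suc s..n. 1 - x ^ k)) +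
         (- 1) ^ Suc j * x ^ (Suc j * Suc n + \<Sum>{..j}) * (\<Prod>k=Suc j..n. 1 - x ^ k)"
  using assms
proof (induction j)
  case 0
  then show ?case by (simp add: algebra_simps)
next
  case (Suc j)
  define a where "a = x ^ (Suc j * Suc n + \<Sum>{..j})"
  define u where "u = x ^ Suc j"
  define v where "v = x ^ Suc n"
  define q where "q = (\<Prod>k=Suc (Suc j)..n. 1 - x ^ k)"
  have q: "(\<Prod>k=Suc j..n. 1 - x ^ k) = (1 - u) * q"
    using Suc.prems by (simp add: prod.atLeast_Suc_atMost u_def q_def)
  \<comment> \<open>In terms of \<open>a\<close>: the new summand on the left, its counterpart for
    \<open>n\<close>, and the new remainder. Up to sign the step is then \<open>a * (1 - u) * q + a
    * u * q * (1 - v) = a * q - a * u * v * q\<close>.\<close>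
  have 1: "x ^ (Suc j * Suc n + (\<Sum>{..j} + Suc j)) = a * u"
    unfolding a_def u_def power_add[symmetric] by (simp add: algebra_simps)
  have 2: "x ^ (Suc j * n + (\<Sum>{..j} + Suc j)) = a"
    unfolding a_def by (simp add: algebra_simps)
  have 3: "x ^ (Suc (Suc j) * Suc n + (\<Sum>{..j} + Suc j)) = a * u * v"
    unfolding a_def u_def v_def power_add[symmetric] by (simp add: algebra_simps)
  have IH: "(\<Sum>s\<le>j. (- 1) ^ s * x ^ (s * Suc n + \<Sum>{..s}) * (\<Prod>k=Suc s..n. 1 - x ^ k)) * (1 - v) =
         (\<Sum>s\<le>j. (- 1) ^ s * x ^ (s * n + \<Sum>{..s}) * (\<Prod>k=Suc s..n. 1 - x ^ k)) +
         (- 1) ^ Suc j * a * ((1 - u) * q)"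
    using Suc unfolding q v_def a_def by simp
  show ?case
    unfolding sum.atMost_Suc[of _ j] v_def[symmetric] distrib_right IH 1 2 3 q_def[symmetric]
    by (simp add: algebra_simps)
qed

text \<open>In the induction, \<open>shanks_step\<close> with \<open>j = n\<close> yields the sum
  for \<open>n\<close> plus the first power for \<open>m = n\<close>; the summand
  \<open>s = Suc n\<close>, whose product is empty, supplies the second power. The exponents on the
  right are the two generalized pentagonal numbers of index \<open>Suc m\<close>, written without
  division.\<close>

lemma shanks_identity:
  fixes x :: "'a::comm_ring_1"
  shows "(\<Sum>s\<le>n. (- 1) ^ s * x ^ (s * n + \<Sum>{..s}) * (\<Prod>k=Suc s..n. 1 - x ^ k)) =
         1 + (\<Sum>m<n. (- 1) ^ Suc m * (x ^ (Suc m * Suc m + \<Sum>{..m}) + x ^ (Suc m * Suc m + \<Sum>{..Suc m})))"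
proof (induction n)
  case 0
  then show ?case by simp
next
  case (Suc n)
  have "(\<Sum>s\<le>n. (- 1) ^ s * x ^ (s * Suc n + \<Sum>{..s}) * (\<Prod>k=Suc s..Suc n. 1 - x ^ k)) =
        (\<Sum>s\<le>n. (- 1) ^ s * x ^ (s * Suc n + \<Sum>{..s}) * (\<Prod>k=Suc s..n. 1 - x ^ k)) * (1 - x ^ Suc n)"
    unfolding sum_distrib_right by (intro sum.cong) (auto simp: mult.assoc)
  also have "\<dots> = (\<Sum>s\<le>n. (- 1) ^ s * x ^ (s * n + \<Sum>{..s}) * (\<Prod>k=Suc s..n. 1 - x ^ k)) +
         (- 1) ^ Suc n * x ^ (Suc n * Suc n + \<Sum>{..n})"
    by (subst shanks_step) auto
  finally show ?case
    unfolding sum.atMost_Suc[of _ n] sum.lessThan_Suc Suc by (simp add: algebra_simps)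
qed

lemma pentagonal_series_summable:
  fixes x :: real
  assumes "0 \<le> x" "x < 1"
  shows "summable (\<lambda>m. (- 1) ^ Suc m * (x ^ (Suc m * Suc m + \<Sum>{..m}) + x ^ (Suc m * Suc m + \<Sum>{..Suc m})))"
proof (rule summable_comparison_test')
  show "summable (\<lambda>m. 2 * x ^ m)"
    using assms by (intro summable_mult summable_geometric) auto
  fix m :: nat
  have "x ^ (Suc m * Suc m + \<Sum>{..m}) \<le> x ^ m" "x ^ (Suc m * Suc m + \<Sum>{..Suc m}) \<le> x ^ m"
    using assms by (intro power_decreasing; simp)+
  then show "norm ((- 1) ^ Suc m * (x ^ (Suc m * Suc m + \<Sum>{..m}) + x ^ (Suc m * Suc m + \<Sum>{..Suc m}))) \<le> 2 * x ^ m"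
    using assms by (simp only: norm_mult norm_power) simp
qed

theorem pentagonal_number_theorem:
  fixes x :: real
  assumes "0 \<le> x" "x < 1"
  shows "(\<lambda>n. \<Prod>k=1..n. 1 - x ^ k) \<longlonglongrightarrow>
    1 + (\<Sum>m. (- 1) ^ Suc m * (x ^ (Suc m * Suc m + \<Sum>{..m}) + x ^ (Suc m * Suc m + \<Sum>{..Suc m})))"
proof -
  define R where "R n = (\<Sum>s=Suc 0..n. (- 1) ^ s * x ^ (s * n + \<Sum>{..s}) * (\<Prod>k=Suc s..n. 1 - x ^ k))" for n
  define S where "S n = 1 + (\<Sum>m<n. (- 1) ^ Suc m * (x ^ (Suc m * Suc m + \<Sum>{..m}) + x ^ (Suc m * Suc m + \<Sum>{..Suc m})))" for n
  \<comment> \<open>The summand \<open>s = 0\<close> of Shanks' sum is the whole product;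
    \<open>R\<close> collects the others.\<close>
  have P: "(\<Prod>k=1..n. 1 - x ^ k) = S n - R n" for n
    using shanks_identity[where x=x and n=n] unfolding S_def R_def
    by (simp add: atMost_atLeast0 sum.atLeast_Suc_atMost)
  \<comment> \<open>Each of the \<open>n\<close> summands of \<open>R n\<close> has \<open>s\<close>
    at least 1, hence a power of \<open>x\<close> of exponent at least \<open>n\<close>.\<close>
  have R: "norm (R n) \<le> real n * x ^ n" for n
  proof -
    have "norm (R n) \<le> (\<Sum>s=Suc 0..n. x ^ n)"
      unfolding R_def
    proof (rule sum_norm_le)
      fix s assume s: "s \<in> {Suc 0..n}"
      have "n \<le> s * n + \<Sum>{..s}" using s by (simp add: trans_le_add1)
      then have "x ^ (s * n + \<Sum>{..s}) \<le> x ^ n"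
        using assms by (intro power_decreasing) auto
      moreover have "norm (\<Prod>k=Suc s..n. 1 - x ^ k) \<le> 1"
        unfolding prod_norm[symmetric] using assms
        by (intro prod_le_1) (auto simp: power_le_one)
      ultimately have "x ^ (s * n + \<Sum>{..s}) * norm (\<Prod>k=Suc s..n. 1 - x ^ k) \<le> x ^ n * 1"
        using assms by (intro mult_mono) auto
      then show "norm ((- 1) ^ s * x ^ (s * n + \<Sum>{..s}) * (\<Prod>k=Suc s..n. 1 - x ^ k)) \<le> x ^ n"
        using assms by (simp add: norm_mult norm_power abs_mult)
    qed
    then show ?thesis by simp
  qed
  have "(\<lambda>n. real n * x ^ n) \<longlonglongrightarrow> 0"
    using assms by (intro powser_times_n_limit_0) auto
  then have "R \<longlonglongrightarrow> 0"
    by (rule Lim_null_comparison[rotated]) (use R in auto)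
  moreover have "S \<longlonglongrightarrow> 1 + (\<Sum>m. (- 1) ^ Suc m * (x ^ (Suc m * Suc m + \<Sum>{..m}) + x ^ (Suc m * Suc m + \<Sum>{..Suc m})))"
    unfolding S_def by (intro tendsto_intros summable_LIMSEQ pentagonal_series_summable assms)
  ultimately show ?thesis unfolding P by (auto intro: tendsto_eq_intros)
qed

section \<open>The pentagonal series as a function of \<open>y\<close>, with
  \<open>x = exp (- y)\<close>\<close>

text \<open>For \<open>y > 0\<close> this is Euler's function, the infinite product of
  \<open>1 - q ^ k\<close>, at \<open>q = exp (- y)\<close>. The series form gives measurability
  directly and can be integrated term by term.\<close>

definition pent_series :: "real \<Rightarrow> real" where
  "pent_series y = 1 + (\<Sum>n. (- 1) ^ Suc n * (exp (- (pentagonal_minus (Suc n) * y)) + exp (- (pentagonal_plus (Suc n) * y))))"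

lemma pentagonal_minus_Suc: "pentagonal_minus (Suc n) = real (Suc n * Suc n + \<Sum>{..n})"
proof -
  have "real (\<Sum>{..n}) = real n * (real n + 1) / 2"
    by (induction n) (simp_all add: field_simps)
  then show ?thesis
    by (simp only: pentagonal_minus_def of_nat_add of_nat_mult of_nat_Suc) (simp add: field_simps)
qed

lemma pentagonal_plus_eq: "pentagonal_plus n = pentagonal_minus n + real n"
  by (simp add: pentagonal_plus_def pentagonal_minus_def field_simps)

lemma pentagonal_plus_Suc: "pentagonal_plus (Suc n) = real (Suc n * Suc n + \<Sum>{..Suc n})"
  by (simp add: pentagonal_plus_eq pentagonal_minus_Suc)

lemma power_exp_minus: "exp (- y) ^ n = exp (- (real n * y))"
  by (simp add: exp_of_nat_mult[symmetric])

lemma euler_product_tendsto: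
  assumes "y > 0"
  shows "(\<lambda>n. \<Prod>k=1..n. 1 - exp (- (real k * y))) \<longlonglongrightarrow> pent_series y"
  using pentagonal_number_theorem[of "exp (- y)"] assms
  unfolding pent_series_def pentagonal_minus_Suc pentagonal_plus_Suc power_exp_minus by simp

text \<open>The sign is hidden in the alternating series but visible in the partial
  products.\<close>

lemma pent_series_nonneg: "y > 0 \<Longrightarrow> 0 \<le> pent_series y"
  by (rule LIMSEQ_le_const[OF euler_product_tendsto]) (auto intro!: prod_nonneg exI[of _ 0])

text \<open>Quadratic growth is what makes the integrals of the series terms absolutely
  summable.\<close>

lemma pentagonal_minus_ge: "pentagonal_minus (Suc n) \<ge> real (Suc n) ^ 2"
  unfolding pentagonal_minus_Suc power2_eq_square of_nat_mult[symmetric] of_nat_le_iff by simp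

section \<open>Laplace transforms on the open half line\<close>

text \<open>The endpoint 0 is excluded because the pentagonal series diverges there.\<close>

abbreviation half_line :: "real measure" where
  "half_line \<equiv> restrict_space lborel {0<..}"

lemma nn_integral_exponential_density:
  assumes "a > 0" and [measurable]: "f \<in> borel_measurable borel"
  shows "(\<integral>\<^sup>+y. ennreal (exponential_density a y) * f y \<partial>lborel) =
         (\<integral>\<^sup>+y. ennreal (a * exp (- (a * y))) * f y \<partial>half_line)"
proof -
  have "(\<integral>\<^sup>+y. ennreal (exponential_density a y) * f y \<partial>lborel) =
        (\<integral>\<^sup>+y. ennreal (a * exp (- (a * y))) * f y * indicator {0<..} y \<partial>lborel)"
    \<comment> \<open>\<open>exponential_density\<close> is also positive at 0, so the integrands
      differ on the null set \<open>{0}\<close> only.\<close>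
    by (rule nn_integral_cong_AE, rule AE_I[where N="{0}"])
       (auto simp: exponential_density_def indicator_def mult.commute split: if_splits)
  then show ?thesis
    by (subst nn_integral_restrict_space) auto
qed

text \<open>Read off from the total mass 1 of the exponential distribution, with no antiderivative
  computed.\<close>

lemma exp_half_line:
  fixes a :: real
  assumes a: "a > 0"
  shows integrable_exp_half_line: "integrable half_line (\<lambda>y. exp (- (a * y)))"
    and integral_exp_half_line: "(\<integral>y. exp (- (a * y)) \<partial>half_line) = 1 / a"
proof -
  interpret E: prob_space "density lborel (exponential_density a)"
    using a by (rule prob_space_exponential_density)
  have "(\<integral>\<^sup>+y. ennreal (exponential_density a y) * 1 \<partial>lborel) = 1"
    using E.emeasure_space_1 by (simp add: emeasure_density)
  then have "(\<integral>\<^sup>+y. ennreal (a * exp (- (a * y))) \<partial>half_line) = ennreal 1"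
    using a by (subst (asm) nn_integral_exponential_density) auto
  then have *: "integrable half_line (\<lambda>y. a * exp (- (a * y)))" "(\<integral>y. a * exp (- (a * y)) \<partial>half_line) = 1"
    by (subst (asm) nn_integral_eq_integrable; use a in \<open>auto intro!: measurable_restrict_space1\<close>)+
  then show "integrable half_line (\<lambda>y. exp (- (a * y)))" "(\<integral>y. exp (- (a * y)) \<partial>half_line) = 1 / a"
    using a by (simp_all add: field_simps)
qed

lemma space_half_line [simp]: "space half_line = {0<..}"
  by (simp add: space_restrict_space)

lemma pent_series_measurable [measurable]: "pent_series \<in> borel_measurable borel"
  unfolding pent_series_def by measurable

text \<open>Sum and integral may be exchanged because the L1 norms of the terms are at most
  \<open>2 / (Suc n)^2\<close>. With \<open>a = r * (l + 1)\<close>, the terms \<open>c n\<close>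
  are those of the inner series.\<close>

lemma pent_series_transform:
  fixes a :: real
  assumes a: "a > 0"
  defines "c \<equiv> \<lambda>n. (- 1) ^ Suc n * (1 / (a + pentagonal_minus (Suc n)) + 1 / (a + pentagonal_plus (Suc n)))"
  shows summable_pent_transform: "summable c"
    and integrable_pent_transform: "integrable half_line (\<lambda>y. exp (- (a * y)) * pent_series y)"
    and integral_pent_transform: "(\<integral>y. exp (- (a * y)) * pent_series y \<partial>half_line) = 1 / a + suminf c"
proof -
  let ?p = "\<lambda>n. a + pentagonal_minus (Suc n)" and ?q = "\<lambda>n. a + pentagonal_plus (Suc n)"
  define g where "g n y = (- 1) ^ Suc n * (exp (- (pentagonal_minus (Suc n) * y)) + exp (- (pentagonal_plus (Suc n) * y)))" for n y
  define f where "f n y = (- 1) ^ Suc n * (exp (- (?p n * y)) + exp (- (?q n * y)))" for n y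
  have fg: "f n y = exp (- (a * y)) * g n y" for n y
    by (simp add: f_def g_def algebra_simps flip: exp_add)
  have ge: "real (Suc n) ^ 2 \<le> ?p n" "?p n \<le> ?q n" for n
    using pentagonal_minus_ge[of n] a by (auto simp: pentagonal_plus_eq)
  have pos: "?p n > 0" "?q n > 0" for n
  proof -
    have "0 < real (Suc n) ^ 2" by simp
    then show "?p n > 0" "?q n > 0" using ge[of n] by linarith+
  qed
  have int_abs: "integrable half_line (\<lambda>y. exp (- (?p n * y)) + exp (- (?q n * y)))"
    "(\<integral>y. exp (- (?p n * y)) + exp (- (?q n * y)) \<partial>half_line) = 1 / ?p n + 1 / ?q n" for n
    using pos[of n] by (simp_all add: exp_half_line)
  have int: "integrable half_line (f n)" "integral\<^sup>L half_line (f n) = c n" for n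
    unfolding f_def c_def using int_abs[of n] by simp_all
  have norm_f: "norm (f n y) = exp (- (?p n * y)) + exp (- (?q n * y))" for n y
    unfolding f_def norm_mult norm_power by simp
  have summ: "summable (\<lambda>n. norm (f n y))" if "y > 0" for y
  proof (rule summable_comparison_test')
    show "summable (\<lambda>n. 2 * exp (- y) ^ n)"
      using that by (intro summable_mult summable_geometric) auto
    fix n
    have "real n \<le> real (Suc n) ^ 2" by (simp add: power2_eq_square algebra_simps)
    then have "real n \<le> ?p n" "real n \<le> ?q n" using ge[of n] by linarith+
    then have "exp (- (?p n * y)) \<le> exp (- y) ^ n" "exp (- (?q n * y)) \<le> exp (- y) ^ n"
      using that unfolding power_exp_minus by (auto intro!: mult_right_mono)
    then show "norm (norm (f n y)) \<le> 2 * exp (- y) ^ n"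
      unfolding norm_f by simp
  qed
  have AE: "AE y in half_line. summable (\<lambda>n. norm (f n y))"
    using summ by (intro AE_I2) simp
  have sums: "summable (\<lambda>n. \<integral>y. norm (f n y) \<partial>half_line)"
  proof (rule summable_comparison_test')
    show "summable (\<lambda>n. 2 * inverse (real (Suc n) ^ 2))"
      by (intro summable_mult, subst summable_Suc_iff) (simp add: inverse_power_summable)
    fix n
    have "1 / ?p n \<le> inverse (real (Suc n) ^ 2)" "1 / ?q n \<le> inverse (real (Suc n) ^ 2)"
      using ge[of n] pos[of n] by (simp_all add: divide_inverse del: of_nat_Suc)
    then show "norm (\<integral>y. norm (f n y) \<partial>half_line) \<le> 2 * inverse (real (Suc n) ^ 2)"
      unfolding norm_f int_abs using pos[of n] by simp
  qed
  have expand: "exp (- (a * y)) * pent_series y = exp (- (a * y)) + (\<Sum>n. f n y)" if "y > 0" for y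
  proof -
    \<comment> \<open>Summability passes from \<open>f\<close> to \<open>g\<close> by cancelling the
      nonzero factor \<open>exp (- (a * y))\<close>; it is needed to move that factor into the
      sum.\<close>
    have "summable (\<lambda>n. exp (- (a * y)) * g n y)"
      using summable_norm_cancel[OF summ[OF that]] unfolding fg .
    then have "summable (\<lambda>n. g n y)" by (simp add: summable_cmult_iff)
    then show ?thesis
      unfolding pent_series_def fg g_def[symmetric] by (simp add: suminf_mult distrib_left)
  qed
  show "summable c"
    using summable_integral[OF int(1) AE sums] unfolding int .
  have *: "integrable half_line (\<lambda>y. exp (- (a * y)) + (\<Sum>n. f n y))"
    by (intro Bochner_Integration.integrable_add integrable_exp_half_line a integrable_suminf int AE sums)
  then show "integrable half_line (\<lambda>y. exp (- (a * y)) * pent_series y)"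
    by (subst Bochner_Integration.integrable_cong[OF refl expand]) auto
  have "(\<integral>y. exp (- (a * y)) * pent_series y \<partial>half_line) = (\<integral>y. exp (- (a * y)) + (\<Sum>n. f n y) \<partial>half_line)"
    by (intro Bochner_Integration.integral_cong refl expand) simp
  also have "\<dots> = 1 / a + (\<Sum>n. integral\<^sup>L half_line (f n))"
    using integral_suminf[OF int(1) AE sums] integrable_suminf[OF int(1) AE sums] a
    by (simp add: exp_half_line)
  finally show "(\<integral>y. exp (- (a * y)) * pent_series y \<partial>half_line) = 1 / a + suminf c"
    unfolding int .
qed

section \<open>Conditioning on one of finitely many independent variables\<close>

text \<open>By independence the joint law is a product measure, and Tonelli's theorem lets
  coordinate \<open>r\<close> be integrated last.\<close>

lemma (in prob_space) emeasure_indep_vars_all_le: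
  fixes Y :: "'i \<Rightarrow> 'a \<Rightarrow> real"
  assumes J: "finite J" "r \<notin> J" and indep: "indep_vars (\<lambda>_. borel) Y (insert r J)"
  shows "emeasure M {\<omega> \<in> space M. \<forall>k\<in>J. Y k \<omega> \<le> Y r \<omega>} =
         (\<integral>\<^sup>+y. (\<Prod>k\<in>J. emeasure M {\<omega> \<in> space M. Y k \<omega> \<le> y}) \<partial>distr M borel (Y r))"
proof -
  let ?I = "insert r J"
  have rv [measurable]: "\<And>i. i \<in> ?I \<Longrightarrow> random_variable borel (Y i)"
    using indep unfolding indep_vars_def2 by blast
  \<comment> \<open>Outside the index set a point mass fills in, since the product locale wants a
    sigma-finite measure at every index.\<close>
  define D where "D i = (if i \<in> ?I then distr M borel (Y i) else return borel 0)" for i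
  have D: "prob_space (D i)" for i
    using rv by (auto simp: D_def intro: prob_space_distr prob_space_return)
  have sets_D [measurable_cong, simp]: "sets (D i) = sets borel" for i
    by (simp add: D_def)
  have space_D [simp]: "space (D i) = UNIV" for i
    by (simp add: D_def)
  interpret product_sigma_finite D
    using D by (simp add: product_sigma_finite_def prob_space_imp_sigma_finite)
  have sets_Pi [measurable_cong]: "sets (PiM I D) = sets (PiM I (\<lambda>_. borel))" for I
    by (intro sets_PiM_cong) auto
  define E where "E = {f \<in> space (PiM ?I (\<lambda>_. borel :: real measure)). \<forall>k\<in>J. f k \<le> f r}"
  have E [measurable]: "E \<in> sets (PiM ?I (\<lambda>_. borel))"
    unfolding E_def using J(1)
    by (intro sets.sets_Collect_finite_All borel_measurable_le measurable_component_singleton) auto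
  have "emeasure M {\<omega> \<in> space M. \<forall>k\<in>J. Y k \<omega> \<le> Y r \<omega>} =
        emeasure (distr M (PiM ?I (\<lambda>_. borel)) (\<lambda>x. \<lambda>i\<in>?I. Y i x)) E"
    using J by (subst emeasure_distr[OF _ E]) (auto intro!: arg_cong[where f="emeasure M"] measurable_restrict rv simp: E_def space_PiM)
  also have "distr M (PiM ?I (\<lambda>_. borel)) (\<lambda>x. \<lambda>i\<in>?I. Y i x) = PiM ?I (\<lambda>i. distr M borel (Y i))"
    using indep by (subst (asm) indep_vars_iff_distr_eq_PiM') (auto simp: rv)
  also have "\<dots> = PiM ?I D"
    by (intro PiM_cong) (auto simp: D_def)
  also have "emeasure (PiM ?I D) E = (\<integral>\<^sup>+f. indicator E f \<partial>PiM ?I D)"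
    by (rule nn_integral_indicator[symmetric]) (simp add: sets_Pi)
  also have "\<dots> = (\<integral>\<^sup>+y. (\<integral>\<^sup>+f. indicator E (f(r := y)) \<partial>PiM J D) \<partial>D r)"
    using J by (intro product_nn_integral_insert_rev) auto
  also have "\<dots> = (\<integral>\<^sup>+y. (\<Prod>k\<in>J. emeasure M {\<omega> \<in> space M. Y k \<omega> \<le> y}) \<partial>D r)"
  proof (rule nn_integral_cong)
    fix y
    \<comment> \<open>Once coordinate \<open>r\<close> is fixed at \<open>y\<close>, the event is a
      box with all sides \<open>{..y}\<close>.\<close>
    have "(\<integral>\<^sup>+f. indicator E (f(r := y)) \<partial>PiM J D) = (\<integral>\<^sup>+f. indicator (PiE J (\<lambda>_. {..y})) f \<partial>PiM J D)"
      using J by (intro nn_integral_cong) (auto simp: E_def space_PiM indicator_def PiE_iff extensional_def)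
    also have "\<dots> = emeasure (PiM J D) (PiE J (\<lambda>_. {..y}))"
      using J by (intro nn_integral_indicator sets_PiM_I_finite) auto
    also have "\<dots> = (\<Prod>k\<in>J. emeasure (D k) {..y})"
      using J by (intro emeasure_PiM) auto
    also have "\<dots> = (\<Prod>k\<in>J. emeasure M {\<omega> \<in> space M. Y k \<omega> \<le> y})"
      by (intro prod.cong) (auto simp: D_def emeasure_distr intro!: arg_cong[where f="emeasure M"])
    finally show "(\<integral>\<^sup>+f. indicator E (f(r := y)) \<partial>PiM J D) = (\<Prod>k\<in>J. emeasure M {\<omega> \<in> space M. Y k \<omega> \<le> y})" .
  qed
  also have "D r = distr M borel (Y r)" by (simp add: D_def)
  finally show ?thesis .
qed

section \<open>The density of the maximum and its expansion\<close>

text \<open>As soon as \<open>n\<close> reaches \<open>r\<close>, omitting the factor of index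
  \<open>r\<close> is division by it.\<close>

lemma omitted_product_tendsto:
  fixes y :: real
  assumes y: "y > 0" and r: "r \<ge> 1"
  shows "(\<lambda>n. \<Prod>k\<in>{1..n} - {r}. 1 - exp (- (real k * y))) \<longlonglongrightarrow> pent_series y / (1 - exp (- (real r * y)))"
proof -
  have nz: "1 - exp (- (real r * y)) \<noteq> 0" using y r by simp
  have "(\<lambda>n. (\<Prod>k=1..n. 1 - exp (- (real k * y))) / (1 - exp (- (real r * y))))
        \<longlonglongrightarrow> pent_series y / (1 - exp (- (real r * y)))"
    by (intro tendsto_divide euler_product_tendsto y tendsto_const nz)
  then show ?thesis
  proof (rule Lim_transform_eventually)
    show "\<forall>\<^sub>F n in sequentially. (\<Prod>k=1..n. 1 - exp (- (real k * y))) / (1 - exp (- (real r * y))) =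
            (\<Prod>k\<in>{1..n} - {r}. 1 - exp (- (real k * y)))"
      using eventually_ge_at_top[of r]
      by eventually_elim (use r nz in \<open>simp add: prod.remove[of _ r]\<close>)
  qed
qed

lemma omitted_product_bounds:
  fixes y :: real
  assumes "y \<ge> 0"
  shows "0 \<le> (\<Prod>k\<in>K. 1 - exp (- (real k * y)))" "(\<Prod>k\<in>K. 1 - exp (- (real k * y))) \<le> 1"
  using assms by (auto intro!: prod_nonneg prod_le_1)

text \<open>The density of \<open>Y r\<close> on the event that it is the maximum, divided by \<open>r\<close>.\<close>

definition max_density :: "nat \<Rightarrow> real \<Rightarrow> real" where
  "max_density r y = exp (- (real r * y)) * (pent_series y / (1 - exp (- (real r * y))))"

text \<open>The quotient is a limit of products of factors in [0,1]. The upper bound gives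
  integrability although the denominator vanishes as \<open>y\<close> tends to 0.\<close>

lemma max_density_bounds:
  assumes "y > 0" "r \<ge> 1"
  shows "0 \<le> max_density r y" "max_density r y \<le> exp (- (real r * y))"
proof -
  have "pent_series y / (1 - exp (- (real r * y))) \<le> 1"
    by (rule LIMSEQ_le_const2[OF omitted_product_tendsto[OF assms]])
       (use omitted_product_bounds assms in auto)
  then show "max_density r y \<le> exp (- (real r * y))"
    unfolding max_density_def by (intro mult_left_le) auto
  show "0 \<le> max_density r y"
    unfolding max_density_def using assms pent_series_nonneg[of y] by simp
qed

lemma max_density_measurable [measurable]: "max_density r \<in> borel_measurable borel"
  unfolding max_density_def by measurable

lemma integrable_max_density:
  assumes "r \<ge> 1"
  shows "integrable half_line (max_density r)"
proof (rule Bochner_Integration.integrable_bound)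
  show "integrable half_line (\<lambda>y. exp (- (real r * y)))"
    using assms by (intro integrable_exp_half_line) auto
  show "max_density r \<in> borel_measurable half_line"
    by (intro measurable_restrict_space1) simp
  show "AE y in half_line. norm (max_density r y) \<le> norm (exp (- (real r * y)))"
    using assms by (intro AE_I2) (use max_density_bounds in auto)
qed

lemma outer_term_sums:
  assumes r: "r \<ge> 1"
  shows "summable (\<lambda>n. inner_term r l (Suc n))"
    and "outer_term r sums (\<integral>y. max_density r y \<partial>half_line)"
proof -
  let ?a = "\<lambda>l. real r * (real l + 1)"
  have a: "?a l > 0" for l using r by simp
  have inner: "inner_term r l (Suc n) = (- 1) ^ Suc n *
      (1 / (?a l + pentagonal_minus (Suc n)) + 1 / (?a l + pentagonal_plus (Suc n)))" for l n
    by (simp add: inner_term_def)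
  show "summable (\<lambda>n. inner_term r l (Suc n))"
    unfolding inner by (rule summable_pent_transform[OF a])
  define f where "f l y = exp (- (?a l * y)) * pent_series y" for l y
  have int: "integrable half_line (f l)" "integral\<^sup>L half_line (f l) = outer_term r l" for l
    unfolding f_def outer_term_def inner by (rule integrable_pent_transform integral_pent_transform, rule a)+
  have f_sums: "(\<lambda>l. f l y) sums max_density r y" if y: "y > 0" for y
  proof -
    have "(\<lambda>l. exp (- (real r * y)) ^ l) sums (1 / (1 - exp (- (real r * y))))"
      using y r by (intro geometric_sums) simp
    \<comment> \<open>The prefactor \<open>exp (- (real r * y))\<close> shifts the exponents of the
      geometric series from \<open>l\<close> to \<open>l + 1\<close>.\<close>
    from sums_mult[OF this, of "exp (- (real r * y)) * pent_series y"]
    show ?thesis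
      by (simp add: f_def max_density_def power_exp_minus algebra_simps flip: exp_add exp_of_nat_mult)
  qed
  have f_nonneg: "f l y \<ge> 0" if "y > 0" for l y
    using pent_series_nonneg[OF that] by (simp add: f_def)
  have "(\<lambda>n. \<integral>y. (\<Sum>l<n. f l y) \<partial>half_line) \<longlonglongrightarrow> (\<integral>y. max_density r y \<partial>half_line)"
  \<comment> \<open>The terms are nonnegative, so the limit itself dominates the partial
    sums.\<close>
  proof (rule integral_dominated_convergence[where w="max_density r"])
    show "AE y in half_line. (\<lambda>n. \<Sum>l<n. f l y) \<longlonglongrightarrow> max_density r y"
      using f_sums by (intro AE_I2) (simp add: sums_def)
    show "AE y in half_line. norm (\<Sum>l<n. f l y) \<le> max_density r y" for n
    proof (rule AE_I2)
      fix y assume "y \<in> space half_line"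
      then have y: "y > 0" by simp
      have "(\<Sum>l<n. f l y) \<le> max_density r y"
        using f_sums[OF y] f_nonneg[OF y] sum_le_suminf[of "\<lambda>l. f l y" "{..<n}"] by (simp add: sums_iff)
      moreover have "0 \<le> (\<Sum>l<n. f l y)" by (intro sum_nonneg f_nonneg y)
      ultimately show "norm (\<Sum>l<n. f l y) \<le> max_density r y" by simp
    qed
  qed (use r int in \<open>auto intro: integrable_max_density borel_measurable_integrable[OF integrable_max_density] borel_measurable_integrable borel_measurable_sum\<close>)
  then show "outer_term r sums (\<integral>y. max_density r y \<partial>half_line)"
    unfolding sums_def using int by simp
qed

section \<open>The probability of being the maximum\<close>

text \<open>The comparison of \<open>Y r\<close> with itself is trivial; removing index
  \<open>r\<close> meets the condition \<open>r \<notin> J\<close> of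
  \<open>emeasure_indep_vars_all_le\<close>.\<close>

lemma (in prob_space) prob_first_n_le:
  fixes Y :: "nat \<Rightarrow> 'a \<Rightarrow> real"
  assumes indep: "indep_vars (\<lambda>_. borel) Y {1..}"
    and exp: "\<And>k. k \<ge> 1 \<Longrightarrow> distributed M lborel (Y k) (\<lambda>t. ennreal (exponential_density (real k) t))"
    and r: "r \<ge> 1"
  shows "prob {\<omega> \<in> space M. \<forall>k\<in>{1..n} - {r}. Y k \<omega> \<le> Y r \<omega>} =
    (\<integral>y. real r * exp (- (real r * y)) * (\<Prod>k\<in>{1..n} - {r}. 1 - exp (- (real k * y))) \<partial>half_line)"
proof -
  let ?J = "{1..n} - {r}"
  let ?Q = "\<lambda>y. \<Prod>k\<in>?J. 1 - exp (- (real k * y))"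
  let ?F = "\<lambda>y. \<Prod>k\<in>?J. emeasure M {\<omega> \<in> space M. Y k \<omega> \<le> y}"
  have rv [measurable]: "random_variable borel (Y k)" if "k \<ge> 1" for k
    using distributed_measurable[OF exp[OF that]] by simp
  have F: "?F y = ennreal (?Q y)" if y: "y \<ge> 0" for y
  proof -
    have "emeasure M {\<omega> \<in> space M. Y k \<omega> \<le> y} = ennreal (1 - exp (- (real k * y)))" if "k \<in> ?J" for k
      using exponential_distributedD_le[OF exp y, of k] that by (simp add: emeasure_eq_measure mult.commute)
    then show ?thesis
      using y by (subst prod_ennreal[symmetric]) auto
  qed
  have "emeasure M {\<omega> \<in> space M. \<forall>k\<in>?J. Y k \<omega> \<le> Y r \<omega>} = (\<integral>\<^sup>+y. ?F y \<partial>distr M borel (Y r))"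
    using r by (intro emeasure_indep_vars_all_le indep_vars_subset[OF indep]) auto
  also have "distr M borel (Y r) = distr M lborel (Y r)"
    by (intro distr_cong) auto
  also have "distr M lborel (Y r) = density lborel (\<lambda>t. ennreal (exponential_density (real r) t))"
    by (rule distributed_distr_eq_density[OF exp[OF r]])
  also have "(\<integral>\<^sup>+y. ?F y \<partial>density lborel (\<lambda>t. ennreal (exponential_density (real r) t))) =
    (\<integral>\<^sup>+y. ?Q y \<partial>density lborel (\<lambda>t. ennreal (exponential_density (real r) t)))"
    \<comment> \<open>\<open>F\<close> covers only \<open>y \<ge> 0\<close>, which suffices because
      the density vanishes for negative \<open>y\<close>.\<close>
    by (intro nn_integral_cong_AE) (auto simp: AE_density exponential_density_def F[simplified])
  also have "\<dots> = (\<integral>\<^sup>+y. ennreal (exponential_density (real r) y) * ennreal (?Q y) \<partial>lborel)"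
    by (intro nn_integral_density) auto
  also have "\<dots> = (\<integral>\<^sup>+y. ennreal (real r * exp (- (real r * y))) * ennreal (?Q y) \<partial>half_line)"
    using r by (intro nn_integral_exponential_density) auto
  also have "\<dots> = (\<integral>\<^sup>+y. ennreal (real r * exp (- (real r * y)) * ?Q y) \<partial>half_line)"
    by (intro nn_integral_cong ennreal_mult[symmetric]) (auto intro!: omitted_product_bounds)
  finally have "(\<integral>\<^sup>+y. ennreal (real r * exp (- (real r * y)) * ?Q y) \<partial>half_line) =
      ennreal (prob {\<omega> \<in> space M. \<forall>k\<in>?J. Y k \<omega> \<le> Y r \<omega>})"
    by (simp add: emeasure_eq_measure)
  then show ?thesis
    by (subst (asm) nn_integral_eq_integrable)
       (auto intro!: measurable_restrict_space1 AE_I2 mult_nonneg_nonneg omitted_product_bounds)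
qed

text \<open>Two limits of \<open>prob (?A n)\<close> are compared: continuity from above along the
  decreasing events gives \<open>max_prob M Y r\<close>, and dominated convergence gives the
  integral.\<close>

lemma (in prob_space) max_prob_eq_integral:
  fixes Y :: "nat \<Rightarrow> 'a \<Rightarrow> real"
  assumes indep: "indep_vars (\<lambda>_. borel) Y {1..}"
    and exp: "\<And>k. k \<ge> 1 \<Longrightarrow> distributed M lborel (Y k) (\<lambda>t. ennreal (exponential_density (real k) t))"
    and r: "r \<ge> 1"
  shows "max_prob M Y r = real r * (\<integral>y. max_density r y \<partial>half_line)"
proof -
  let ?A = "\<lambda>n. {\<omega> \<in> space M. \<forall>k\<in>{1..n} - {r}. Y k \<omega> \<le> Y r \<omega>}"
  have rv [measurable]: "random_variable borel (Y k)" if "k \<ge> 1" for k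
    using distributed_measurable[OF exp[OF that]] by simp
  have prob_eq: "prob (?A n) =
      (\<integral>y. real r * exp (- (real r * y)) * (\<Prod>k\<in>{1..n} - {r}. 1 - exp (- (real k * y))) \<partial>half_line)" for n
    using indep exp r by (rule prob_first_n_le)
  have "?A n \<in> events" for n
    using r by (intro sets.sets_Collect_finite_All borel_measurable_le rv) auto
  then have "(\<lambda>n. prob (?A n)) \<longlonglongrightarrow> prob (\<Inter>n. ?A n)"
    by (intro finite_Lim_measure_decseq) (auto simp: decseq_def)
  also have "(\<Inter>n. ?A n) = {\<omega> \<in> space M. \<forall>k\<ge>1. Y k \<omega> \<le> Y r \<omega>}"
    by fastforce
  finally have "(\<lambda>n. prob (?A n)) \<longlonglongrightarrow> max_prob M Y r"
    by (simp add: max_prob_def)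
  moreover have "(\<lambda>n. prob (?A n)) \<longlonglongrightarrow> (\<integral>y. real r * max_density r y \<partial>half_line)"
    unfolding prob_eq
  \<comment> \<open>The omitted products are at most 1, so the density of \<open>Y r\<close>
    dominates for all \<open>n\<close>.\<close>
  proof (rule integral_dominated_convergence[where w="\<lambda>y. real r * exp (- (real r * y))"])
    show "AE y in half_line. (\<lambda>n. real r * exp (- (real r * y)) * (\<Prod>k\<in>{1..n} - {r}. 1 - exp (- (real k * y))))
        \<longlonglongrightarrow> real r * max_density r y"
      unfolding max_density_def mult.assoc
      by (intro AE_I2 tendsto_mult tendsto_const omitted_product_tendsto r) simp
    show "AE y in half_line. norm (real r * exp (- (real r * y)) * (\<Prod>k\<in>{1..n} - {r}. 1 - exp (- (real k * y))))
        \<le> real r * exp (- (real r * y))" for n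
      by (intro AE_I2) (use omitted_product_bounds in \<open>simp add: abs_mult mult_left_le\<close>)
  qed (use r in \<open>auto intro!: measurable_restrict_space1 integrable_exp_half_line\<close>)
  ultimately show ?thesis
    using LIMSEQ_unique by fastforce
qed

text \<open>As \<open>suminf\<close> assigns a value to divergent series too, the two summability
  claims are what make the equation one between convergent sums.\<close>

theorem proposition5p1:
  fixes M :: "'a measure" and Y :: "nat \<Rightarrow> 'a \<Rightarrow> real" and r :: nat
  assumes "prob_space M"
    and "prob_space.indep_vars M (\<lambda>_. borel) Y {1..}"
    and "\<And>k. k \<ge> 1 \<Longrightarrow> distributed M lborel (Y k) (\<lambda>t. ennreal (exponential_density (real k) t))"
    and "r \<ge> 1"
  shows "(\<forall>l. summable (\<lambda>n. inner_term r l (Suc n))) \<and>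
         summable (outer_term r) \<and>
         max_prob M Y r = real r * (\<Sum>l. outer_term r l)"
  using prob_space.max_prob_eq_integral[of M Y r] assms outer_term_sums[OF assms(4)]
  by (auto simp: sums_iff)

end
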